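(* Let $p$ be a prime and $n \in \mathbb{Z}_{\geq 1}$. Fix any $k \in \mathbb{Z}_{\geq 1}$ and a finite abelian $p$-group $G$ such that $p^{k}G = 0$. Write $r_{p}(G) := \dim_{\mathbb{F}_{p}}(G/pG)$ and $u_{p}(G) := \dim_{\mathbb{F}_{p}}(p^{k-1}G)$. If $X$ is chosen uniformly at random from $\mathrm{M}_{n}(\mathbb{Z}/p^{k}\mathbb{Z})$, then $$\mathrm{Prob}(\mathrm{cok}(X) \simeq G) = \frac{1}{|\mathrm{Aut}_{\mathbb{Z}}(G)|}\left(\prod_{i=u_{p}(G) + 1}^{n}(1 - p^{-i})\right) \left(\prod_{i=n - r_{p}(G) + 1}^{n}(1 - p^{-i})\right).$$
   Context: $\mathrm{M}_{n}(A)$ denotes the ring of $n \times n$ matrices over a commutative ring $A$ with unity, and $\mathbb{F}_{p} = \mathbb{Z}/p\mathbb{Z}$. $\mathrm{cok}(X) = (\mathbb{Z}/p^{k}\mathbb{Z})^{n}/X(\mathbb{Z}/p^{k}\mathbb{Z})^{n}$, and the isomorphism is one of abelian groups. $\mathrm{Aut}_{\mathbb{Z}}(G)$ is the group of automorphisms of the abelian group $G$. A product whose lower index exceeds its upper index is empty and equal to $1$. *)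

theory Defs
  imports
    "HOL-Probability.Probability_Mass_Function"
    "HOL-Number_Theory.Residues"
    "HOL-Algebra.Algebra"
    "Jordan_Normal_Form.Missing_VectorSpace"
begin

section \<open>Matrices over a ring and their cokernels\<close>

definition free_grp :: "('a, 'b) ring_scheme \<Rightarrow> nat \<Rightarrow> (nat \<Rightarrow> 'a) monoid" where
  "free_grp R n = product_group {..<n} (\<lambda>_. add_monoid R)"

text \<open>
  The entry of \<open>A\<close> in row \<open>i\<close> and column \<open>j\<close>, both counted from 0, is \<open>A i j\<close>. Extensionality
  makes each matrix correspond to exactly one function, which the uniform distribution relies on.
\<close>

definition sq_matrices :: "('a, 'b) ring_scheme \<Rightarrow> nat \<Rightarrow> (nat \<Rightarrow> nat \<Rightarrow> 'a) set" where
  "sq_matrices R n = {..<n} \<rightarrow>\<^sub>E ({..<n} \<rightarrow>\<^sub>E carrier R)"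

definition mat_apply ::
    "('a, 'b) ring_scheme \<Rightarrow> nat \<Rightarrow> (nat \<Rightarrow> nat \<Rightarrow> 'a) \<Rightarrow> (nat \<Rightarrow> 'a) \<Rightarrow> nat \<Rightarrow> 'a" where
  "mat_apply R n A v = (\<lambda>i\<in>{..<n}. \<Oplus>\<^bsub>R\<^esub>j\<in>{..<n}. A i j \<otimes>\<^bsub>R\<^esub> v j)"

definition cok :: "('a, 'b) ring_scheme \<Rightarrow> nat \<Rightarrow> (nat \<Rightarrow> nat \<Rightarrow> 'a) \<Rightarrow> (nat \<Rightarrow> 'a) set monoid" where
  "cok R n A = free_grp R n Mod (mat_apply R n A ` carrier (free_grp R n))"

section \<open>The invariants of a finite abelian group\<close>

text \<open>Abelian groups are written multiplicatively, so this is \<open>mG\<close>.\<close>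

definition multiples :: "('a, 'b) monoid_scheme \<Rightarrow> nat \<Rightarrow> 'a set" where
  "multiples G m = (\<lambda>x. x [^]\<^bsub>G\<^esub> m) ` carrier G"

text \<open>
  An abelian group \<open>H\<close> with \<open>pH = 0\<close> as a vector space over \<open>residue_ring p\<close>. The record type of
  modules extends that of rings, but the multiplication and unit fields play no role for a module.
\<close>

definition as_module :: "('a, 'b) monoid_scheme \<Rightarrow> (int, 'a) module" where
  "as_module H = \<lparr>carrier = carrier H, monoid.mult = undefined, one = undefined,
     ring.zero = \<one>\<^bsub>H\<^esub>, add = (\<lambda>x y. x \<otimes>\<^bsub>H\<^esub> y), smult = (\<lambda>c x. x [^]\<^bsub>H\<^esub> c)\<rparr>"

definition r_inv :: "nat \<Rightarrow> ('a, 'b) monoid_scheme \<Rightarrow> nat" where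
  "r_inv p G = vectorspace.dim (residue_ring (int p)) (as_module (G Mod multiples G p))"

definition u_inv :: "nat \<Rightarrow> nat \<Rightarrow> ('a, 'b) monoid_scheme \<Rightarrow> nat" where
  "u_inv p k G =
     vectorspace.dim (residue_ring (int p)) (as_module (G\<lparr>carrier := multiples G (p ^ (k - 1))\<rparr>))"

end

theory Submission
  imports Defs
begin

text \<open>
  Let \<open>R\<close> be the ring of residues modulo \<open>p\<^sup>k\<close>. Matrices with cokernel \<open>G\<close> are counted by adding an
  identification of the cokernel with \<open>G\<close>, which amounts to a surjection \<open>f\<close> from \<open>R\<^sup>n\<close> to \<open>G\<close> with
  kernel \<open>im A\<close>. For a given \<open>A\<close> with cokernel isomorphic to \<open>G\<close> there are \<open>|Aut G|\<close> choices of \<open>f\<close>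
  (\<open>card_presentations\<close>). Conversely, for a given surjection \<open>f\<close> with kernel \<open>K\<close>, the suitable
  matrices are those whose columns form a generating \<open>n\<close>-tuple of \<open>K\<close>
  (\<open>card_matrices_with_image\<close>). Surjections \<open>f\<close> themselves are generating \<open>n\<close>-tuples of \<open>G\<close>. Hence
  everything reduces to counting generating tuples of finite abelian \<open>p\<close>-groups.

  A uniformly random \<open>n\<close>-tuple in such a group \<open>M\<close> of rank \<open>r = dim (M/pM)\<close> generates \<open>M\<close> with
  probability \<open>(1 - p\<^bsup>-n\<^esup>) \<cdots> (1 - p\<^bsup>r-1-n\<^esup>)\<close> (\<open>card_generating_tuples\<close>): by Nakayama's lemma one may
  compute modulo \<open>pM\<close>, and the count over the field with \<open>p\<close> elements satisfies a simple recursion.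
  For \<open>M = G\<close> this gives the product that involves \<open>r\<^sub>p(G)\<close>. The kernel \<open>K\<close> has rank \<open>n - u\<^sub>p(G)\<close>
  whatever \<open>f\<close> is (\<open>card_kernel_mod_p\<close>), which gives the other product. The remaining factors
  \<open>|G|\<^sup>n |K|\<^sup>n\<close> cancel against the number \<open>|R\<^sup>n|\<^sup>n\<close> of all matrices.
\<close>

section \<open>Generating tuples of finite abelian p-groups\<close>

lemma (in group) int_pow_mod_exponent:
  fixes m :: nat and z :: int
  assumes x: "x \<in> carrier G" and "x [^] m = \<one>"
  shows "x [^] (z mod int m) = x [^] z"
proof -
  have "x [^] z = x [^] (int m * (z div int m)) \<otimes> x [^] (z mod int m)"
    using x by (simp add: int_pow_mult[symmetric])
  moreover have "x [^] (int m * (z div int m)) = (x [^] m) [^] (z div int m)"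
    using x by (metis int_pow_int int_pow_pow)
  ultimately show ?thesis using assms by simp
qed

context comm_group
begin

lemma subgroup_pow_image:
  assumes "subgroup M G"
  shows "subgroup ((\<lambda>x. x [^] (m::nat)) ` M) G"
proof -
  have "group_hom G G (\<lambda>x. x [^] m)"
    by unfold_locales (auto simp: hom_def nat_pow_distrib)
  then show ?thesis using assms by (rule group_hom.subgroup_img_is_subgroup)
qed

lemma generate_absorb:
  assumes "A \<subseteq> carrier G" "B \<subseteq> carrier G"
  shows "generate G (generate G A \<union> B) = generate G (A \<union> B)"
proof (rule antisym)
  have AB: "A \<union> B \<subseteq> carrier G" using assms by auto
  have "generate G A \<subseteq> generate G (A \<union> B)" by (rule mono_generate) auto
  then show "generate G (generate G A \<union> B) \<subseteq> generate G (A \<union> B)"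
    by (intro generate_subgroup_incl generate_is_subgroup AB) (auto intro: generate.incl)
  show "generate G (A \<union> B) \<subseteq> generate G (generate G A \<union> B)"
    by (rule mono_generate) (auto intro: generate.incl)
qed

lemma generate_subgroup: "subgroup N G \<Longrightarrow> generate G N = N"
  using generateI[of N N] by auto

text \<open>
  Adjoining to \<open>N\<close> an element \<open>g\<close> with \<open>g\<^sup>p \<in> N\<close> multiplies the order by exactly \<open>p\<close>: the products
  \<open>x g\<^sup>i\<close> with \<open>x \<in> N\<close> and \<open>0 \<le> i < p\<close> exhaust the new group, and they are distinct because otherwise
  a power of \<open>g\<close> with exponent prime to \<open>p\<close>, hence \<open>g\<close> itself, would lie in \<open>N\<close>.
\<close>

lemma card_generate_insert:
  assumes N: "subgroup N G" and g: "g \<in> carrier G" "g \<notin> N"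
    and p: "Factorial_Ring.prime p" and gp: "g [^] p \<in> N"
  shows "card (generate G (insert g N)) = p * card N"
proof -
  define f where "f = (\<lambda>(x, i::int). x \<otimes> g [^] i)"
  have Nc: "x \<in> carrier G" if "x \<in> N" for x using N that by (rule subgroup.mem_carrier)
  have p0: "p > 0" using p prime_gt_0_nat by auto
  have gpz: "g [^] (int p * z) \<in> N" for z
  proof -
    have "g [^] (int p * z) = (g [^] p) [^] z" using g by (metis int_pow_int int_pow_pow)
    then show ?thesis using subgroup_int_pow_closed[OF N gp] by simp
  qed
  have subset: "f ` (N \<times> {0..<int p}) = f ` (N \<times> UNIV)"
  proof -
    have "f (x, i) \<in> f ` (N \<times> {0..<int p})" if x: "x \<in> N" for x i
    proof -
      have "g [^] i = g [^] (int p * (i div int p)) \<otimes> g [^] (i mod int p)"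
        using g by (simp add: int_pow_mult[symmetric])
      then have "f (x, i) = f (x \<otimes> g [^] (int p * (i div int p)), i mod int p)"
        using g Nc x by (simp add: f_def m_assoc)
      moreover have "x \<otimes> g [^] (int p * (i div int p)) \<in> N"
        using x gpz by (rule subgroup.m_closed[OF N])
      ultimately show ?thesis using p0 by auto
    qed
    then show ?thesis by auto
  qed
  have inj: "inj_on f (N \<times> {0..<int p})"
  proof -
    have key: "i = j" if h: "x \<in> N" "y \<in> N" "x \<otimes> g [^] i = y \<otimes> g [^] j" "i < int p" "j < int p"
        "0 \<le> i" "0 \<le> j" for x y and i j :: int
    proof (rule ccontr)
      assume ne: "i \<noteq> j"
      have "inv y \<otimes> (x \<otimes> g [^] i) \<otimes> g [^] (- i) = inv y \<otimes> (y \<otimes> g [^] j) \<otimes> g [^] (- i)"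
        using h by simp
      then have "inv y \<otimes> x = g [^] (j - i)"
        using h(1,2) g Nc by (simp add: m_assoc int_pow_mult[symmetric]) (simp add: m_assoc[symmetric] int_pow_mult[symmetric])
      then have d: "g [^] (j - i) \<in> N"
        using h by (metis subgroup.m_closed[OF N] subgroup.m_inv_closed[OF N])
      have "\<not> int p dvd j - i"
        using h ne zdvd_imp_le[of "int p" "\<bar>j - i\<bar>"] by auto
      then have "coprime (int p) (j - i)"
        using p by (simp add: prime_imp_coprime)
      then obtain a b where ab: "a * int p + b * (j - i) = 1"
        by (metis bezout_int coprime_iff_gcd_eq_1)
      have "g = g [^] (int p * a) \<otimes> g [^] ((j - i) * b)"
        using ab g by (simp add: mult.commute int_pow_mult[symmetric])
      also have "g [^] ((j - i) * b) = (g [^] (j - i)) [^] b"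
        using g by (simp add: int_pow_pow)
      also have "g [^] (int p * a) \<otimes> \<dots> \<in> N"
        by (rule subgroup.m_closed[OF N gpz subgroup_int_pow_closed[OF N d]])
      finally show False using g by simp
    qed
    show ?thesis
    proof (rule inj_onI, clarsimp simp: f_def)
      fix x y and i j :: int
      assume h: "x \<in> N" "y \<in> N" "0 \<le> i" "i < int p" "0 \<le> j" "j < int p"
        "x \<otimes> g [^] i = y \<otimes> g [^] j"
      have "i = j" using key[of x y i j] h by auto
      then show "x = y \<and> i = j" using h g Nc by (simp add: r_cancel)
    qed
  qed
  have "f ` (N \<times> UNIV) = generate G (insert g N)"
  proof (rule generateI)
    show "subgroup (f ` (N \<times> UNIV)) G"
    proof (rule subgroupI)
      show "f ` (N \<times> UNIV) \<subseteq> carrier G" using g Nc by (auto simp: f_def)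
      show "f ` (N \<times> UNIV) \<noteq> {}" using subgroup.one_closed[OF N] by auto
      fix a assume "a \<in> f ` (N \<times> UNIV)"
      then obtain x i where x: "x \<in> N" "a = f (x, i)" by auto
      have "inv a = f (inv x, - i)"
        using x g Nc by (simp add: f_def inv_mult int_pow_neg)
      then show "inv a \<in> f ` (N \<times> UNIV)"
        using subgroup.m_inv_closed[OF N x(1)] by auto
      fix b assume "b \<in> f ` (N \<times> UNIV)"
      then obtain y j where y: "y \<in> N" "b = f (y, j)" by auto
      have "a \<otimes> b = f (x \<otimes> y, i + j)"
        using x y g Nc by (simp add: f_def int_pow_mult m_ac)
      then show "a \<otimes> b \<in> f ` (N \<times> UNIV)"
        using subgroup.m_closed[OF N x(1) y(1)] by auto
    qed
    show "insert g N \<subseteq> f ` (N \<times> UNIV)"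
    proof -
      have "g = f (\<one>, 1)" "x = f (x, 0)" if "x \<in> N" for x
        using g Nc that by (auto simp: f_def)
      then show ?thesis using subgroup.one_closed[OF N] by blast
    qed
    fix K assume K: "subgroup K G" "insert g N \<subseteq> K"
    then show "f ` (N \<times> UNIV) \<subseteq> K"
      by (auto simp: f_def intro!: subgroup.m_closed[OF K(1)] subgroup_int_pow_closed)
  qed
  then have "card (generate G (insert g N)) = card (f ` (N \<times> {0..<int p}))"
    using subset by simp
  then show ?thesis using inj by (simp add: card_image card_cartesian_product)
qed

text \<open>
  Working with tuples that generate \<open>M\<close> together with a fixed subgroup \<open>N\<close> makes an induction on the
  length of the tuple possible without passing to quotients. The first chosen element \<open>g\<close> either lies
  in \<open>N\<close> and changes nothing, or it replaces \<open>N\<close> by a subgroup whose index in \<open>M\<close> is smaller by the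
  factor \<open>p\<close>. Writing \<open>Q n r\<close> for the product below, this amounts to the recursion
  \<open>Q (n + 1) r = p\<^bsup>-r\<^esup> Q n r + (1 - p\<^bsup>-r\<^esup>) Q n (r - 1)\<close>. In length 0 the product vanishes for \<open>r > 0\<close>
  because of its factor for \<open>i = 0\<close>, as it should: the empty tuple generates nothing new.
\<close>

lemma card_generating_tuples_mod:
  assumes M: "subgroup M G" and finM: "finite M" and p: "Factorial_Ring.prime p"
    and "subgroup N G" "N \<subseteq> M" "\<And>x. x \<in> M \<Longrightarrow> x [^] p \<in> N" "card M = p ^ r * card N"
  shows "real (card {t \<in> {..<n} \<rightarrow>\<^sub>E M. generate G (N \<union> t ` {..<n}) = M})
       = real (card M) ^ n * (\<Prod>i<r. 1 - real p ^ i / real p ^ n)"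
  using assms(4-)
proof (induction n arbitrary: N r)
  case 0
  have p1: "p > 1" using p prime_gt_1_nat by auto
  have cN: "card N > 0" using 0(1,2) finM by (metis card_gt_0_iff empty_iff finite_subset subgroup.one_closed)
  show ?case
  proof (cases "r = 0")
    case True
    then have "N = M" using 0 finM by (metis card_subset_eq mult_1 power_0)
    then have "{t \<in> {..<0::nat} \<rightarrow>\<^sub>E M. generate G (N \<union> t ` {..<0}) = M} = {\<lambda>_. undefined}"
      using generate_subgroup[OF M] by auto
    then show ?thesis using True by simp
  next
    case False
    then have "p ^ r > 1" using p1 by (metis bot_nat_0.not_eq_extremum one_less_power)
    then have "card M \<noteq> card N" using 0(4) cN False by auto
    then have "N \<noteq> M" by auto
    then have e: "{t \<in> {..<0::nat} \<rightarrow>\<^sub>E M. generate G (N \<union> t ` {..<0}) = M} = {}"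
      using generate_subgroup[OF 0(1)] by auto
    have "(\<Prod>i<r. 1 - real p ^ i / real p ^ 0) = 0"
      using False by (intro prod_zero) (auto intro!: bexI[of _ 0])
    then show ?thesis unfolding e by simp
  qed
next
  case (Suc n)
  define S where "S = (\<lambda>N. {t \<in> {..<n} \<rightarrow>\<^sub>E M. generate G (N \<union> t ` {..<n}) = M})"
  define Q where "Q = (\<lambda>n r. \<Prod>i<r. 1 - real p ^ i / real p ^ n)"
  have p0: "p > 0" using p prime_gt_0_nat by auto
  have Mc: "M \<subseteq> carrier G" using M by (rule subgroup.subset)
  have finN: "finite N" using Suc finM by (metis finite_subset)
  have cN: "card N > 0" using Suc finN by (metis card_gt_0_iff empty_iff subgroup.one_closed)
  have finP: "finite ({..<n} \<rightarrow>\<^sub>E M)" using finM by (intro finite_PiE) auto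
  have finS: "finite (S N')" for N' unfolding S_def using finP by auto
  have IH: "real (card (S N')) = real (card M) ^ n * Q n r'"
    if "subgroup N' G" "N' \<subseteq> M" "\<And>x. x \<in> M \<Longrightarrow> x [^] p \<in> N'" "card M = p ^ r' * card N'" for N' r'
    unfolding S_def Q_def by (rule Suc.IH[OF that])
  have gsub: "generate G (insert g N) \<subseteq> M" if "g \<in> M" for g
    using that Suc.prems(2) by (intro generate_subgroup_incl M) auto
  \<comment> \<open>The entry at position \<open>n\<close>, not the one at position 0, is treated as the first choice.\<close>
  have split: "generate G (N \<union> (t(n := g)) ` {..<Suc n})
      = generate G (generate G (insert g N) \<union> t ` {..<n})" if "t \<in> {..<n} \<rightarrow>\<^sub>E M" "g \<in> M" for t g
  proof -
    have "(t(n := g)) ` {..<Suc n} = insert g (t ` {..<n})" by (auto simp: lessThan_Suc)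
    then show ?thesis
      using that Suc.prems(2) Mc by (subst generate_absorb) (auto simp: PiE_iff)
  qed
  have im: "{t \<in> {..<Suc n} \<rightarrow>\<^sub>E M. generate G (N \<union> t ` {..<Suc n}) = M}
      = (\<lambda>(g, t). t(n := g)) ` (SIGMA g:M. S (generate G (insert g N)))"
  proof -
    have "{..<Suc n} \<rightarrow>\<^sub>E M = (\<lambda>(g, t). t(n := g)) ` (M \<times> ({..<n} \<rightarrow>\<^sub>E M))"
      by (simp only: lessThan_Suc PiE_insert_eq)
    moreover have "{y \<in> F ` Y. P y} = F ` {x \<in> Y. P (F x)}"
      for F :: "'a \<times> (nat \<Rightarrow> 'a) \<Rightarrow> nat \<Rightarrow> 'a" and Y P by auto
    ultimately have "{t \<in> {..<Suc n} \<rightarrow>\<^sub>E M. generate G (N \<union> t ` {..<Suc n}) = M}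
        = (\<lambda>(g, t). t(n := g)) ` {x \<in> M \<times> ({..<n} \<rightarrow>\<^sub>E M).
            generate G (N \<union> (case x of (g, t) \<Rightarrow> t(n := g)) ` {..<Suc n}) = M}" by simp
    also have "{x \<in> M \<times> ({..<n} \<rightarrow>\<^sub>E M).
            generate G (N \<union> (case x of (g, t) \<Rightarrow> t(n := g)) ` {..<Suc n}) = M}
        = (SIGMA g:M. S (generate G (insert g N)))"
      unfolding S_def using split by (auto simp del: fun_upd_apply)
    finally show ?thesis .
  qed
  have "inj_on (\<lambda>(g, t). t(n := g)) (M \<times> ({..<n} \<rightarrow>\<^sub>E M))"
    using inj_combinator[of n "{..<n}" "\<lambda>_. M"] by simp
  then have inj: "inj_on (\<lambda>(g, t). t(n := g)) (SIGMA g:M. S (generate G (insert g N)))"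
    by (rule inj_on_subset) (auto simp: S_def)
  have "card {t \<in> {..<Suc n} \<rightarrow>\<^sub>E M. generate G (N \<union> t ` {..<Suc n}) = M}
      = card (SIGMA g:M. S (generate G (insert g N)))"
    unfolding im by (rule card_image[OF inj])
  also have "\<dots> = (\<Sum>g\<in>M. card (S (generate G (insert g N))))"
    using finM finS by (intro card_SigmaI) auto
  also have "\<dots> = (\<Sum>g\<in>N. card (S (generate G (insert g N)))) + (\<Sum>g\<in>M - N. card (S (generate G (insert g N))))"
    using Suc.prems(2) finM by (metis add.commute sum.subset_diff)
  also have "real \<dots> = real (card N) * (real (card M) ^ n * Q n r)
      + real (card M - card N) * (real (card M) ^ n * Q n (r - 1))"
  proof -
    have 1: "real (card (S (generate G (insert g N)))) = real (card M) ^ n * Q n r" if "g \<in> N" for g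
      using that generate_subgroup[OF Suc.prems(1)] IH[OF Suc.prems] by (simp add: insert_absorb)
    have 2: "real (card (S (generate G (insert g N)))) = real (card M) ^ n * Q n (r - 1)"
      if g: "g \<in> M - N" for g
    proof (rule IH)
      have ins: "insert g N \<subseteq> carrier G" using g Mc Suc.prems(2) by auto
      show "subgroup (generate G (insert g N)) G" using ins by (rule generate_is_subgroup)
      show "generate G (insert g N) \<subseteq> M" using g gsub by auto
      show "x [^] p \<in> generate G (insert g N)" if "x \<in> M" for x
        using Suc.prems(3)[OF that] by (auto intro: generate.incl)
      have "r \<noteq> 0"
      proof
        assume "r = 0"
        then have "N = M" using Suc.prems finM by (metis card_subset_eq mult_1 power_0)
        then show False using g by auto
      qed
      moreover have "card (generate G (insert g N)) = p * card N"
        using g Mc Suc.prems p by (intro card_generate_insert) auto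
      ultimately show "card M = p ^ (r - 1) * card (generate G (insert g N))"
        using Suc.prems(4) by (simp add: power_eq_if)
    qed
    have "card (M - N) = card M - card N"
      using finN Suc.prems(2) by (rule card_Diff_subset)
    then show ?thesis using 1 2 by simp
  qed
  also have "\<dots> = real (card M) ^ Suc n * Q (Suc n) r"
  proof (cases r)
    case 0
    then show ?thesis using Suc.prems(4) by (simp add: Q_def)
  next
    case (Suc r')
    \<comment> \<open>Cancelling \<open>p\<close> in the factors with \<open>i > 0\<close> turns the product for \<open>n + 1\<close> into the one for \<open>n\<close>.\<close>
    have shift: "Q (Suc n) (Suc r') = (1 - 1 / real p ^ Suc n) * Q n r'"
      unfolding Q_def prod.lessThan_Suc_shift using p0 by simp
    have last: "Q n (Suc r') = Q n r' * (1 - real p ^ r' / real p ^ n)"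
      by (simp add: Q_def)
    have M: "real (card M) = real p ^ Suc r' * real (card N)"
      using Suc.prems(4) Suc by (simp add: algebra_simps)
    have le: "card N \<le> card M" using Suc.prems(2) finM by (rule card_mono[rotated])
    show ?thesis
      unfolding Suc shift last of_nat_diff[OF le] diff_Suc_1 power_Suc[of "real (card M)"]
      unfolding M using p0 cN by (simp add: field_simps)
  qed
  finally show ?case by (simp add: Q_def)
qed

text \<open>
  Nakayama's lemma for abelian groups of exponent dividing \<open>p\<^sup>k\<close>. If \<open>M\<close> is generated by \<open>S\<close> and the
  \<open>p\<close>-th powers, every element of \<open>M\<close> has the form \<open>h y\<^sup>p\<close> with \<open>h\<close> generated by \<open>S\<close> and \<open>y \<in> M\<close>.
  Substituting this representation into itself \<open>k\<close> times pushes the error term to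
  \<open>y\<close> raised to \<open>p\<^sup>k\<close>, which is trivial.
\<close>

lemma generate_pow_image_Un_iff:
  fixes p k :: nat
  assumes M: "subgroup M G" and S: "S \<subseteq> M" and tors: "\<And>x. x \<in> M \<Longrightarrow> x [^] (p ^ k) = \<one>"
  shows "generate G ((\<lambda>x. x [^] p) ` M \<union> S) = M \<longleftrightarrow> generate G S = M"
proof
  let ?N = "(\<lambda>x. x [^] p) ` M"
  have Mc: "M \<subseteq> carrier G" using M by (rule subgroup.subset)
  have N: "subgroup ?N G" using M by (rule subgroup_pow_image)
  have H: "subgroup (generate G S) G" using S Mc by (intro generate_is_subgroup) auto
  have Hc: "generate G S \<subseteq> carrier G" using H by (rule subgroup.subset)
  have HM: "generate G S \<subseteq> M" using S M by (rule generate_subgroup_incl)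
  have NM: "?N \<subseteq> M"
    using subgroup_int_pow_closed[OF M] by (auto simp flip: int_pow_int)
  show "generate G S = M" if gen: "generate G (?N \<union> S) = M"
  proof -
    have sub: "subgroup (generate G S <#> ?N) G" by (rule mult_subgroups[OF H N])
    have "?N \<union> S \<subseteq> generate G S <#> ?N"
    proof -
      have "x \<in> generate G S <#> ?N" if "x \<in> ?N" for x
      proof -
        have "x = \<one> \<otimes> x" using subgroup.mem_carrier[OF N that] by simp
        then show ?thesis using that subgroup.one_closed[OF H] unfolding set_mult_def by blast
      qed
      moreover have "x \<in> generate G S <#> ?N" if "x \<in> S" for x
      proof -
        have "x \<in> generate G S" using that by (rule generate.incl)
        moreover have "x = x \<otimes> \<one>" using that S Mc by auto
        ultimately show ?thesis using subgroup.one_closed[OF N] unfolding set_mult_def by blast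
      qed
      ultimately show ?thesis by blast
    qed
    then have "generate G (?N \<union> S) \<subseteq> generate G S <#> ?N"
      by (rule generate_subgroup_incl[OF _ sub])
    then have split: "\<exists>h\<in>generate G S. \<exists>y\<in>M. x = h \<otimes> y [^] p" if "x \<in> M" for x
      using that unfolding gen set_mult_def by blast
    have "\<exists>h\<in>generate G S. \<exists>y\<in>M. x = h \<otimes> y [^] (p ^ j)" if "x \<in> M" for x j
    proof (induction j)
      case 0
      then show ?case using that Mc subgroup.one_closed[OF H] by (intro bexI[of _ \<one>] bexI[of _ x]) auto
    next
      case (Suc j)
      then obtain h y where hy: "h \<in> generate G S" "y \<in> M" "x = h \<otimes> y [^] (p ^ j)" by blast
      obtain h' z where hz: "h' \<in> generate G S" "z \<in> M" "y = h' \<otimes> z [^] p" using split[OF hy(2)] by blast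
      have c: "h \<in> carrier G" "h' \<in> carrier G" "z \<in> carrier G" using hy hz Hc Mc by auto
      have "x = h \<otimes> h' [^] (p ^ j) \<otimes> z [^] (p ^ Suc j)"
        using hy(3) hz(3) c by (simp add: nat_pow_distrib nat_pow_pow m_assoc)
      moreover have "h \<otimes> h' [^] (p ^ j) \<in> generate G S"
        using hy(1) subgroup_int_pow_closed[OF H hz(1)] subgroup.m_closed[OF H]
        by (metis int_pow_int)
      ultimately show ?case using hz(2) by blast
    qed
    then have "\<exists>h\<in>generate G S. x = h" if "x \<in> M" for x
      using that tors Hc by (metis r_one subsetD)
    then show ?thesis using HM by blast
  qed
  show "generate G (?N \<union> S) = M" if "generate G S = M"
  proof
    show "generate G (?N \<union> S) \<subseteq> M" using NM S M by (intro generate_subgroup_incl) auto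
    show "M \<subseteq> generate G (?N \<union> S)" using that mono_generate[of S "?N \<union> S"] by auto
  qed
qed

text \<open>
  By Nakayama's lemma the subgroup of \<open>p\<close>-th powers may serve as the auxiliary subgroup of the
  induction above.
\<close>

lemma card_generating_tuples:
  fixes p k :: nat
  assumes M: "subgroup M G" and fin: "finite M" and p: "Factorial_Ring.prime p"
    and tors: "\<And>x. x \<in> M \<Longrightarrow> x [^] (p ^ k) = \<one>"
    and card: "card M = p ^ r * card ((\<lambda>x. x [^] p) ` M)"
  shows "real (card {t \<in> {..<n} \<rightarrow>\<^sub>E M. generate G (t ` {..<n}) = M})
       = real (card M) ^ n * (\<Prod>i<r. 1 - real p ^ i / real p ^ n)"
proof -
  let ?N = "(\<lambda>x. x [^] p) ` M"
  have "?N \<subseteq> M"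
    using subgroup_int_pow_closed[OF M] by (auto simp flip: int_pow_int)
  then have "real (card {t \<in> {..<n} \<rightarrow>\<^sub>E M. generate G (?N \<union> t ` {..<n}) = M})
      = real (card M) ^ n * (\<Prod>i<r. 1 - real p ^ i / real p ^ n)"
    using M by (intro card_generating_tuples_mod[OF M fin p subgroup_pow_image _ _ card]) auto
  moreover have "{t \<in> {..<n} \<rightarrow>\<^sub>E M. generate G (?N \<union> t ` {..<n}) = M}
      = {t \<in> {..<n} \<rightarrow>\<^sub>E M. generate G (t ` {..<n}) = M}"
    using generate_pow_image_Un_iff[OF M _ tors] by (intro Collect_cong conj_cong refl) (auto simp: PiE_iff image_subset_iff)
  ultimately show ?thesis by simp
qed

end

section \<open>The two invariants as orders of groups\<close>

lemma card_vectorspace_eq_power_dim: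
  assumes "vectorspace K V" and fin: "finite (carrier V)"
  shows "card (carrier V) = card (carrier K) ^ vectorspace.dim K V"
proof -
  interpret V: vectorspace K V by (rule assms)
  have "V.fin_dim"
    unfolding V.fin_dim_def using fin V.span_is_subset2[of "carrier V"] V.in_own_span[of "carrier V"] by auto
  then obtain B where B: "finite B" "V.basis B" using V.finite_basis_exists by blast
  have BV: "B \<subseteq> carrier V" using B(2) by (simp add: V.basis_def)
  have uniq: "\<exists>!a. a \<in> B \<rightarrow>\<^sub>E carrier K \<and> V.lincomb a B = v" if "v \<in> carrier V" for v
    using V.basis_criterion[OF B(1) BV] B(2) that by blast
  have lc: "V.lincomb a B \<in> carrier V" if "a \<in> B \<rightarrow>\<^sub>E carrier K" for a
    using that BV by (intro V.lincomb_closed) auto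
  have "bij_betw (\<lambda>a. V.lincomb a B) (B \<rightarrow>\<^sub>E carrier K) (carrier V)"
  proof (rule bij_betwI')
    show "(V.lincomb a B = V.lincomb b B) = (a = b)"
      if "a \<in> B \<rightarrow>\<^sub>E carrier K" "b \<in> B \<rightarrow>\<^sub>E carrier K" for a b
      using uniq[OF lc[OF that(1)]] that by metis
    show "V.lincomb a B \<in> carrier V" if "a \<in> B \<rightarrow>\<^sub>E carrier K" for a
      using lc[OF that] .
    show "\<exists>a\<in>B \<rightarrow>\<^sub>E carrier K. v = V.lincomb a B" if "v \<in> carrier V" for v
      using uniq[OF that] by metis
  qed
  then have "card (carrier V) = card (B \<rightarrow>\<^sub>E carrier K)" by (rule bij_betw_same_card[symmetric])
  also have "\<dots> = card (carrier K) ^ card B" using B(1) by (simp add: card_PiE)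
  finally show ?thesis using V.dim_basis[OF B] by simp
qed

lemma vectorspace_as_module:
  assumes "comm_group H" and p: "Factorial_Ring.prime p"
    and tors: "\<And>x. x \<in> carrier H \<Longrightarrow> x [^]\<^bsub>H\<^esub> p = \<one>\<^bsub>H\<^esub>"
  shows "vectorspace (residue_ring (int p)) (as_module H)"
proof -
  interpret H: comm_group H by (rule assms)
  interpret R: residues_prime p "residue_ring (int p)"
    by unfold_locales (use p in auto)
  have red: "x [^]\<^bsub>H\<^esub> (z mod int p) = x [^]\<^bsub>H\<^esub> z" if "x \<in> carrier H" for x and z :: int
    using H.int_pow_mod_exponent[OF that tors[OF that]] .
  have "abelian_group (as_module H)"
  proof (rule abelian_groupI)
    show "\<exists>y\<in>carrier (as_module H). y \<oplus>\<^bsub>as_module H\<^esub> x = \<zero>\<^bsub>as_module H\<^esub>"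
      if "x \<in> carrier (as_module H)" for x
      using that by (auto simp: as_module_def intro!: bexI[of _ "inv\<^bsub>H\<^esub> x"])
  qed (auto simp: as_module_def H.m_ac)
  then have "module (residue_ring (int p)) (as_module H)"
    by (intro moduleI R.is_cring)
      (auto simp: as_module_def R.res_add_eq R.res_mult_eq R.res_one_eq red H.int_pow_mult
        H.int_pow_distrib H.int_pow_pow mult.commute)
  then show ?thesis
    by (intro vectorspace.intro R.is_field)
qed

lemma card_eq_power_dim_as_module:
  assumes "comm_group H" "finite (carrier H)" and p: "Factorial_Ring.prime p"
    and "\<And>x. x \<in> carrier H \<Longrightarrow> x [^]\<^bsub>H\<^esub> p = \<one>\<^bsub>H\<^esub>"
  shows "card (carrier H) = p ^ vectorspace.dim (residue_ring (int p)) (as_module H)"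
proof -
  have "card (carrier (residue_ring (int p))) = p"
    using prime_gt_0_nat[OF p] by (simp add: residue_ring_def)
  then show ?thesis
    using card_vectorspace_eq_power_dim[OF vectorspace_as_module[OF assms(1,3,4)]] assms(2)
    by (simp add: as_module_def)
qed

context comm_group
begin

lemma order_eq_r_inv:
  assumes fin: "finite (carrier G)" and p: "Factorial_Ring.prime p"
  shows "order G = p ^ r_inv p G * card (multiples G p)"
proof -
  have sub: "subgroup (multiples G p) G"
    unfolding multiples_def by (rule subgroup_pow_image[OF subgroup_self])
  let ?Q = "G Mod multiples G p"
  have Q: "comm_group ?Q" by (rule abelian_FactGroup[OF sub])
  have nor: "multiples G p \<lhd> G" using sub by (simp add: normal_iff_subgroup)
  have finQ: "finite (carrier ?Q)" using fin by (simp add: carrier_FactGroup)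
  have "x [^]\<^bsub>?Q\<^esub> p = \<one>\<^bsub>?Q\<^esub>" if "x \<in> carrier ?Q" for x
  proof -
    obtain g where g: "g \<in> carrier G" "x = multiples G p #> g"
      using \<open>x \<in> carrier ?Q\<close> by (auto simp: carrier_FactGroup)
    then have "x [^]\<^bsub>?Q\<^esub> p = multiples G p #> (g [^] p)"
      using normal.FactGroup_pow[OF nor g(1)] by simp
    also have "\<dots> = multiples G p"
      using g by (intro coset_join2[OF _ sub]) (auto simp: multiples_def)
    finally show ?thesis by simp
  qed
  then have "card (carrier ?Q) = p ^ r_inv p G"
    unfolding r_inv_def by (rule card_eq_power_dim_as_module[OF Q finQ p])
  moreover have "card (carrier ?Q) * card (multiples G p) = order G"
    using lagrange_finite[OF fin sub] by (simp add: FactGroup_def)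
  ultimately show ?thesis by simp
qed

lemma card_multiples_eq_u_inv:
  assumes fin: "finite (carrier G)" and p: "Factorial_Ring.prime p" and k: "k \<ge> 1"
    and tors: "\<And>x. x \<in> carrier G \<Longrightarrow> x [^] (p ^ k) = \<one>"
  shows "card (multiples G (p ^ (k - 1))) = p ^ u_inv p k G"
proof -
  let ?M = "multiples G (p ^ (k - 1))"
  let ?H = "G\<lparr>carrier := ?M\<rparr>"
  have sub: "subgroup ?M G"
    unfolding multiples_def by (rule subgroup_pow_image[OF subgroup_self])
  have H: "comm_group ?H"
    using subgroup.mem_carrier[OF sub]
    by (intro group.group_comm_groupI[OF subgroup_imp_group[OF sub]]) (auto simp: m_comm)
  have "x [^]\<^bsub>?H\<^esub> p = \<one>\<^bsub>?H\<^esub>" if "x \<in> carrier ?H" for x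
  proof -
    have "p ^ (k - 1) * p = p ^ k" using k by (simp add: power_eq_if)
    then show ?thesis
      using that tors by (auto simp: multiples_def nat_pow_pow nat_pow_consistent[symmetric])
  qed
  moreover have "finite ?M" using fin by (simp add: multiples_def)
  ultimately show ?thesis
    unfolding u_inv_def using card_eq_power_dim_as_module[OF H _ p] by simp
qed

end

section \<open>The free module over the residues modulo m\<close>

text \<open>
  The \<open>\<int>\<close>-linear extension to \<open>(\<int>/m)\<^sup>n\<close> of the assignment of \<open>t j\<close> to the \<open>j\<close>-th standard basis vector.
  Residues are represented by integers in \<open>{0..<m}\<close>, so this is a homomorphism only if \<open>m\<close> annihilates
  the entries of \<open>t\<close>.
\<close>

definition lin_ext :: "('a, 'b) monoid_scheme \<Rightarrow> nat \<Rightarrow> (nat \<Rightarrow> 'a) \<Rightarrow> (nat \<Rightarrow> int) \<Rightarrow> 'a" where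
  "lin_ext G n t v = (\<Otimes>\<^bsub>G\<^esub>j\<in>{..<n}. t j [^]\<^bsub>G\<^esub> v j)"

definition std_vec :: "nat \<Rightarrow> nat \<Rightarrow> nat \<Rightarrow> int" where
  "std_vec n j = (\<lambda>i\<in>{..<n}. if i = j then 1 else 0)"

text \<open>
  The outer restriction makes this the transpose of a square matrix, so that it is an involution.
\<close>

definition column :: "nat \<Rightarrow> (nat \<Rightarrow> nat \<Rightarrow> 'a) \<Rightarrow> nat \<Rightarrow> nat \<Rightarrow> 'a" where
  "column n A = (\<lambda>j\<in>{..<n}. \<lambda>i\<in>{..<n}. A i j)"

locale free_residue_module =
  fixes m n :: nat
  assumes m: "m > 1"
begin

abbreviation "R \<equiv> residue_ring (int m)"
abbreviation "P \<equiv> free_grp (residue_ring (int m)) n"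

sublocale R: residues "int m" "residue_ring (int m)"
  using m by unfold_locales auto

lemma carrier_P: "carrier P = {..<n} \<rightarrow>\<^sub>E {0..<int m}"
  by (auto simp: free_grp_def residue_ring_def intro!: PiE_cong)

lemma mult_P: "x \<otimes>\<^bsub>P\<^esub> y = (\<lambda>i\<in>{..<n}. (x i + y i) mod int m)"
  by (simp add: free_grp_def residue_ring_def)

lemma one_P: "\<one>\<^bsub>P\<^esub> = (\<lambda>i\<in>{..<n}. 0)"
  by (simp add: free_grp_def residue_ring_def)

sublocale P: comm_group P
proof (rule group.group_comm_groupI)
  show "group P"
    unfolding free_grp_def by (intro product_group) (rule R.add.is_group)
qed (simp add: mult_P add.commute)

lemma finite_P: "finite (carrier P)"
  unfolding carrier_P by (intro finite_PiE) auto

lemma card_P: "card (carrier P) = m ^ n"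
  unfolding carrier_P by (simp add: card_PiE)

lemma pow_P:
  fixes c :: nat
  assumes "x \<in> carrier P"
  shows "x [^]\<^bsub>P\<^esub> c = (\<lambda>i\<in>{..<n}. (int c * x i) mod int m)"
proof (induction c)
  case 0
  then show ?case by (simp add: one_P)
next
  case (Suc c)
  then show ?case
    by (auto simp: mult_P fun_eq_iff mod_simps algebra_simps restrict_def)
qed

lemma pow_exponent_P: "x \<in> carrier P \<Longrightarrow> x [^]\<^bsub>P\<^esub> m = \<one>\<^bsub>P\<^esub>"
  by (simp add: pow_P one_P)

lemma std_vec_P: "std_vec n j \<in> carrier P"
  using m by (auto simp: carrier_P std_vec_def)

text \<open>
  A vector whose coordinates vanish from index \<open>l\<close> on is built up from the standard basis vectors by
  induction on \<open>l\<close>.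
\<close>

lemma generate_std_vec: "generate P (std_vec n ` {..<n}) = carrier P"
proof
  have sub: "subgroup (generate P (std_vec n ` {..<n})) P"
    using std_vec_P by (intro P.generate_is_subgroup) auto
  show "generate P (std_vec n ` {..<n}) \<subseteq> carrier P"
    using sub by (rule subgroup.subset)
  have "v \<in> generate P (std_vec n ` {..<n})"
    if "v \<in> carrier P" "\<forall>i<n. l \<le> i \<longrightarrow> v i = 0" for v l
    using that
  proof (induction l arbitrary: v)
    case 0
    then have "v = \<one>\<^bsub>P\<^esub>" by (auto simp: one_P carrier_P fun_eq_iff PiE_iff extensional_def)
    then show ?case by (simp add: generate.one)
  next
    case (Suc l)
    show ?case
    proof (cases "l < n")
      case True
      define w where "w = v(l := 0)"
      have w: "w \<in> carrier P"
        using Suc.prems(1) True m by (auto simp: w_def carrier_P PiE_iff extensional_def)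
      have "w \<in> generate P (std_vec n ` {..<n})"
        using Suc.prems by (intro Suc.IH w) (auto simp: w_def)
      moreover have "std_vec n l [^]\<^bsub>P\<^esub> (v l) \<in> generate P (std_vec n ` {..<n})"
        using True by (intro P.subgroup_int_pow_closed[OF sub] generate.incl) auto
      moreover have "v = w \<otimes>\<^bsub>P\<^esub> std_vec n l [^]\<^bsub>P\<^esub> (v l)"
      proof -
        have vl: "0 \<le> v l" "v l < int m" using Suc.prems(1) True by (auto simp: carrier_P PiE_iff)
        have "std_vec n l [^]\<^bsub>P\<^esub> (v l) = std_vec n l [^]\<^bsub>P\<^esub> (nat (v l))"
          using vl(1) by (metis int_pow_int nat_0_le)
        also have "\<dots> = (\<lambda>i\<in>{..<n}. (int (nat (v l)) * std_vec n l i) mod int m)"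
          by (rule pow_P[OF std_vec_P])
        also have "\<dots> = (\<lambda>i\<in>{..<n}. if i = l then v l else 0)"
          using vl by (auto simp: fun_eq_iff std_vec_def)
        finally show ?thesis
          using Suc.prems(1) vl by (auto simp: mult_P w_def fun_eq_iff carrier_P PiE_iff extensional_def)
      qed
      ultimately show ?thesis by (metis generate.eng)
    next
      case False
      then show ?thesis using Suc by auto
    qed
  qed
  from this[of _ n] show "carrier P \<subseteq> generate P (std_vec n ` {..<n})" by auto
qed

lemma hom_image_P:
  assumes "group G" "f \<in> hom P G"
  shows "f ` carrier P = generate G (f ` std_vec n ` {..<n})"
proof -
  interpret f: group_hom P G f
    using assms by (intro group_hom.intro group_hom_axioms.intro P.is_group)
  have "std_vec n ` {..<n} \<subseteq> carrier P" using std_vec_P by auto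
  from f.generate_img[OF this] show ?thesis by (simp add: generate_std_vec)
qed

text \<open>
  Together with \<open>lin_ext_hom\<close> and \<open>lin_ext_std_vec\<close> below this is the universal property:
  homomorphisms from \<open>(\<int>/m)\<^sup>n\<close> to an abelian group \<open>G\<close> annihilated by \<open>m\<close> correspond to \<open>n\<close>-tuples
  in \<open>G\<close>.
\<close>

lemma hom_eqI:
  assumes "group G" and f: "f \<in> hom P G" and g: "g \<in> hom P G"
    and eq: "\<And>j. j < n \<Longrightarrow> f (std_vec n j) = g (std_vec n j)" and v: "v \<in> carrier P"
  shows "f v = g v"
proof -
  interpret f: group_hom P G f
    using assms by (intro group_hom.intro group_hom_axioms.intro P.is_group)
  interpret g: group_hom P G g
    using assms by (intro group_hom.intro group_hom_axioms.intro P.is_group)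
  have S: "std_vec n ` {..<n} \<subseteq> carrier P" using std_vec_P by auto
  have "v \<in> generate P (std_vec n ` {..<n})" using v by (simp add: generate_std_vec)
  then show ?thesis
  proof induction
    case (eng a b)
    then show ?case using P.generate_in_carrier[OF S] by simp
  qed (use S eq in \<open>auto simp: image_subset_iff\<close>)
qed

context
  fixes G :: "('a, 'b) monoid_scheme"
  assumes G: "comm_group G" and tors: "\<And>x. x \<in> carrier G \<Longrightarrow> x [^]\<^bsub>G\<^esub> m = \<one>\<^bsub>G\<^esub>"
begin

interpretation G: comm_group G by (rule G)

lemma lin_ext_hom:
  assumes t: "t \<in> {..<n} \<rightarrow> carrier G"
  shows "lin_ext G n t \<in> hom P G"
proof (rule homI)
  have c: "t j [^]\<^bsub>G\<^esub> (z::int) \<in> carrier G" if "j < n" for j z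
    using t that by (auto simp: Pi_iff)
  show "lin_ext G n t v \<in> carrier G" for v
    unfolding lin_ext_def using c by (intro G.finprod_closed) auto
  fix v w assume "v \<in> carrier P" "w \<in> carrier P"
  have "lin_ext G n t (v \<otimes>\<^bsub>P\<^esub> w) = (\<Otimes>\<^bsub>G\<^esub>j\<in>{..<n}. t j [^]\<^bsub>G\<^esub> v j \<otimes>\<^bsub>G\<^esub> t j [^]\<^bsub>G\<^esub> w j)"
    unfolding lin_ext_def using t c
    by (intro G.finprod_cong')
      (auto simp: mult_P G.int_pow_mod_exponent tors G.int_pow_mult Pi_iff)
  also have "\<dots> = lin_ext G n t v \<otimes>\<^bsub>G\<^esub> lin_ext G n t w"
    unfolding lin_ext_def using c by (intro G.finprod_multf) auto
  finally show "lin_ext G n t (v \<otimes>\<^bsub>P\<^esub> w) = lin_ext G n t v \<otimes>\<^bsub>G\<^esub> lin_ext G n t w" .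
qed

lemma lin_ext_std_vec:
  assumes t: "t \<in> {..<n} \<rightarrow> carrier G" and i: "i < n"
  shows "lin_ext G n t (std_vec n i) = t i"
proof -
  have "lin_ext G n t (std_vec n i) = (\<Otimes>\<^bsub>G\<^esub>j\<in>{..<n}. if i = j then t j else \<one>\<^bsub>G\<^esub>)"
    unfolding lin_ext_def using t by (intro G.finprod_cong') (auto simp: std_vec_def Pi_iff)
  also have "\<dots> = t i" using t i by (intro G.finprod_singleton) auto
  finally show ?thesis .
qed

lemma lin_ext_image:
  assumes t: "t \<in> {..<n} \<rightarrow> carrier G"
  shows "lin_ext G n t ` carrier P = generate G (t ` {..<n})"
proof -
  have "lin_ext G n t ` std_vec n ` {..<n} = t ` {..<n}"
    unfolding image_image using lin_ext_std_vec[OF t] by (intro image_cong) auto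
  then show ?thesis using hom_image_P[OF G.is_group lin_ext_hom[OF t]] by simp
qed

end

lemma mat_apply_hom:
  assumes A: "A \<in> sq_matrices R n"
  shows "mat_apply R n A \<in> hom P P"
proof (rule homI)
  have A': "A i j \<in> carrier R" if "i < n" "j < n" for i j
    using A that by (auto simp: sq_matrices_def PiE_iff)
  have P: "v j \<in> carrier R" if "v \<in> carrier P" "j < n" for v j
    using that by (auto simp: free_grp_def PiE_iff)
  show "mat_apply R n A v \<in> carrier P" if "v \<in> carrier P" for v
    using A' P[OF that] by (auto simp: free_grp_def mat_apply_def intro!: R.finsum_closed)
  fix v w assume v: "v \<in> carrier P" and w: "w \<in> carrier P"
  have "(\<Oplus>\<^bsub>R\<^esub>j\<in>{..<n}. A i j \<otimes>\<^bsub>R\<^esub> (v \<otimes>\<^bsub>P\<^esub> w) j)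
      = (\<Oplus>\<^bsub>R\<^esub>j\<in>{..<n}. A i j \<otimes>\<^bsub>R\<^esub> v j) \<oplus>\<^bsub>R\<^esub> (\<Oplus>\<^bsub>R\<^esub>j\<in>{..<n}. A i j \<otimes>\<^bsub>R\<^esub> w j)"
    if i: "i < n" for i
  proof -
    have "(\<Oplus>\<^bsub>R\<^esub>j\<in>{..<n}. A i j \<otimes>\<^bsub>R\<^esub> (v \<otimes>\<^bsub>P\<^esub> w) j)
        = (\<Oplus>\<^bsub>R\<^esub>j\<in>{..<n}. A i j \<otimes>\<^bsub>R\<^esub> v j \<oplus>\<^bsub>R\<^esub> A i j \<otimes>\<^bsub>R\<^esub> w j)"
      using A'[OF i] P[OF v] P[OF w]
      by (intro R.finsum_cong') (auto simp: free_grp_def R.r_distr)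
    then show ?thesis
      using A'[OF i] P[OF v] P[OF w] by (simp add: R.finsum_addf Pi_iff)
  qed
  then show "mat_apply R n A (v \<otimes>\<^bsub>P\<^esub> w) = mat_apply R n A v \<otimes>\<^bsub>P\<^esub> mat_apply R n A w"
    unfolding mat_apply_def by (auto simp: free_grp_def fun_eq_iff)
qed

lemma mat_apply_std_vec:
  assumes A: "A \<in> sq_matrices R n" and j: "j < n"
  shows "mat_apply R n A (std_vec n j) = column n A j"
proof -
  have A': "A i l \<in> carrier R" if "i < n" "l < n" for i l
    using A that by (auto simp: sq_matrices_def PiE_iff)
  have "(\<Oplus>\<^bsub>R\<^esub>l\<in>{..<n}. A i l \<otimes>\<^bsub>R\<^esub> std_vec n j l) = A i j" if i: "i < n" for i
  proof -
    have "(\<Oplus>\<^bsub>R\<^esub>l\<in>{..<n}. A i l \<otimes>\<^bsub>R\<^esub> std_vec n j l)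
        = (\<Oplus>\<^bsub>R\<^esub>l\<in>{..<n}. if j = l then A i l else \<zero>\<^bsub>R\<^esub>)"
    proof (intro R.finsum_cong')
      show "A i l \<otimes>\<^bsub>R\<^esub> std_vec n j l = (if j = l then A i l else \<zero>\<^bsub>R\<^esub>)" if "l \<in> {..<n}" for l
        using A'[OF i, of l] that R.r_one[of "A i l"] R.r_null[of "A i l"]
        unfolding R.res_one_eq R.res_zero_eq by (auto simp: std_vec_def)
    qed (use A'[OF i] in auto)
    also have "\<dots> = A i j" using A'[OF i] j by (intro R.add.finprod_singleton) auto
    finally show ?thesis .
  qed
  then show ?thesis using j by (auto simp: mat_apply_def column_def fun_eq_iff)
qed

lemma column_bij: "bij_betw (column n) (sq_matrices R n) ({..<n} \<rightarrow>\<^sub>E carrier P)"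
proof -
  have X: "sq_matrices R n = {..<n} \<rightarrow>\<^sub>E carrier P"
    by (simp add: sq_matrices_def free_grp_def)
  have closed: "column n A \<in> sq_matrices R n" if "A \<in> sq_matrices R n" for A
    using that by (auto simp: sq_matrices_def column_def PiE_iff)
  have involution: "column n (column n A) = A" if "A \<in> sq_matrices R n" for A
  proof (intro ext)
    fix i j
    show "column n (column n A) i j = A i j"
    proof (cases "i < n")
      case True
      then have "A i \<in> {..<n} \<rightarrow>\<^sub>E carrier R" using that by (auto simp: sq_matrices_def)
      with True show ?thesis by (cases "j < n") (simp_all add: column_def PiE_iff extensional_def)
    next
      case False
      then have "A i = undefined" using that by (simp add: sq_matrices_def PiE_iff extensional_def)
      with False show ?thesis by (simp add: column_def)
    qed
  qed
  show ?thesis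
    unfolding X[symmetric] using closed involution
    by (intro bij_betw_byWitness[where f' = "column n"]) auto
qed

lemma finite_sq_matrices: "finite (sq_matrices R n)"
  using bij_betw_finite[OF column_bij] finite_P by (simp add: finite_PiE)

lemma card_sq_matrices: "card (sq_matrices R n) = (m ^ n) ^ n"
  using bij_betw_same_card[OF column_bij] by (simp add: card_PiE card_P)

lemma mat_apply_image:
  assumes A: "A \<in> sq_matrices R n"
  shows "mat_apply R n A ` carrier P = generate P (column n A ` {..<n})"
proof -
  have "mat_apply R n A ` std_vec n ` {..<n} = column n A ` {..<n}"
    unfolding image_image using mat_apply_std_vec[OF A] by (intro image_cong) auto
  then show ?thesis using hom_image_P[OF P.is_group mat_apply_hom[OF A]] by simp
qed

text \<open>
  The image of a matrix is the subgroup generated by its columns, because every subgroup of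
  \<open>(\<int>/m)\<^sup>n\<close> is a submodule. This turns the count of matrices with image \<open>N\<close> into a count of
  generating tuples of \<open>N\<close>.
\<close>

lemma card_matrices_with_image:
  assumes N: "N \<subseteq> carrier P"
  shows "card {A \<in> sq_matrices R n. mat_apply R n A ` carrier P = N}
       = card {c \<in> {..<n} \<rightarrow>\<^sub>E N. generate P (c ` {..<n}) = N}"
proof -
  have "c \<in> {..<n} \<rightarrow>\<^sub>E N"
    if "c \<in> {..<n} \<rightarrow>\<^sub>E carrier P" "generate P (c ` {..<n}) = N" for c
    using that by (auto simp: PiE_iff intro: generate.incl)
  then have "{c \<in> {..<n} \<rightarrow>\<^sub>E N. generate P (c ` {..<n}) = N}
      = {c \<in> {..<n} \<rightarrow>\<^sub>E carrier P. generate P (c ` {..<n}) = N}"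
    using N by blast
  also have "\<dots> = column n ` {A \<in> sq_matrices R n. generate P (column n A ` {..<n}) = N}"
    unfolding bij_betw_imp_surj_on[OF column_bij, symmetric] by auto
  also have "card \<dots> = card {A \<in> sq_matrices R n. generate P (column n A ` {..<n}) = N}"
    by (rule card_image, rule inj_on_subset[OF bij_betw_imp_inj_on[OF column_bij]]) auto
  also have "{A \<in> sq_matrices R n. generate P (column n A ` {..<n}) = N}
      = {A \<in> sq_matrices R n. mat_apply R n A ` carrier P = N}"
    by (intro Collect_cong conj_cong refl) (simp add: mat_apply_image)
  finally show ?thesis by simp
qed

end

section \<open>Surjections with a given kernel\<close>

text \<open>
  Both maps identify \<open>G\<close> with the quotient of \<open>P\<close> by the common kernel, and \<open>a\<close> compares the two
  identifications. It is restricted to the carrier since the automorphism group consists of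
  extensional functions.
\<close>

lemma automorphism_between_surjections:
  assumes f: "group_hom P G f" and g: "group_hom P G g"
    and surj: "f ` carrier P = carrier G" "g ` carrier P = carrier G"
    and ker: "kernel P G f = kernel P G g"
  obtains a where "a \<in> auto G" "\<And>v. v \<in> carrier P \<Longrightarrow> a (f v) = g v"
proof -
  interpret f: group_hom P G f by (rule f)
  interpret g: group_hom P G g by (rule g)
  have fibres: "f v = f w \<longleftrightarrow> g v = g w" if "v \<in> carrier P" "w \<in> carrier P" for v w
  proof -
    have *: "h v = h w \<longleftrightarrow> v \<otimes>\<^bsub>P\<^esub> inv\<^bsub>P\<^esub> w \<in> kernel P G h" if "group_hom P G h" for h
    proof -
      interpret h: group_hom P G h by (rule that)
      show ?thesis
        using \<open>v \<in> carrier P\<close> \<open>w \<in> carrier P\<close>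
        by (auto simp: kernel_def f.H.inv_solve_right')
    qed
    show ?thesis using *[OF f] *[OF g] ker by simp
  qed
  define a where "a = (\<lambda>y\<in>carrier G. g (inv_into (carrier P) f y))"
  have a: "a (f v) = g v" if v: "v \<in> carrier P" for v
  proof -
    have "f v \<in> f ` carrier P" using v by blast
    then have "inv_into (carrier P) f (f v) \<in> carrier P" "f (inv_into (carrier P) f (f v)) = f v"
      by (auto intro: inv_into_into f_inv_into_f)
    then show ?thesis using v fibres[of "inv_into (carrier P) f (f v)" v] by (simp add: a_def)
  qed
  have "a \<in> hom G G"
  proof (rule homI)
    fix x y assume x: "x \<in> carrier G" and y: "y \<in> carrier G"
    obtain v w where v: "v \<in> carrier P" "x = f v" and w: "w \<in> carrier P" "y = f w"
      using x y surj(1) by (metis imageE)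
    show "a x \<in> carrier G" using v a by simp
    have "a (x \<otimes>\<^bsub>G\<^esub> y) = a (f (v \<otimes>\<^bsub>P\<^esub> w))" using v w by simp
    also have "\<dots> = g (v \<otimes>\<^bsub>P\<^esub> w)" using v w by (intro a) simp
    also have "\<dots> = a x \<otimes>\<^bsub>G\<^esub> a y" using v w a by simp
    finally show "a (x \<otimes>\<^bsub>G\<^esub> y) = a x \<otimes>\<^bsub>G\<^esub> a y" .
  qed
  moreover have "bij_betw a (carrier G) (carrier G)"
  proof (rule bij_betw_imageI)
    show "inj_on a (carrier G)"
    proof (rule inj_onI)
      fix x y assume x: "x \<in> carrier G" and y: "y \<in> carrier G" and eq: "a x = a y"
      obtain v w where "v \<in> carrier P" "x = f v" "w \<in> carrier P" "y = f w"
        using x y surj(1) by (metis imageE)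
      then show "x = y" using eq a fibres by simp
    qed
    have "a ` carrier G = a ` f ` carrier P" using surj(1) by simp
    also have "\<dots> = g ` carrier P" unfolding image_image using a by (intro image_cong) auto
    finally show "a ` carrier G = carrier G" using surj(2) by simp
  qed
  moreover have "a \<in> extensional (carrier G)" by (simp add: a_def)
  ultimately have "a \<in> auto G" by (simp add: auto_def Bij_def)
  then show ?thesis using a that by blast
qed

context free_residue_module
begin

text \<open>
  The tuples that present \<open>G\<close> on \<open>n\<close> generators with relation module \<open>N\<close>, that is, the surjections from
  \<open>(\<int>/m)\<^sup>n\<close> to \<open>G\<close> with kernel \<open>N\<close>.
\<close>

definition presentations :: "('a, 'b) monoid_scheme \<Rightarrow> (nat \<Rightarrow> int) set \<Rightarrow> (nat \<Rightarrow> 'a) set" where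
  "presentations G N = {t \<in> {..<n} \<rightarrow>\<^sub>E carrier G.
     lin_ext G n t ` carrier P = carrier G \<and> kernel P G (lin_ext G n t) = N}"

context
  fixes G :: "('a, 'b) monoid_scheme"
  assumes G: "comm_group G" and tors: "\<And>x. x \<in> carrier G \<Longrightarrow> x [^]\<^bsub>G\<^esub> m = \<one>\<^bsub>G\<^esub>"
begin

interpretation G: comm_group G by (rule G)

lemma group_hom_lin_ext:
  assumes "t \<in> {..<n} \<rightarrow>\<^sub>E carrier G"
  shows "group_hom P G (lin_ext G n t)"
  using lin_ext_hom[OF G tors, of t] assms
  by (auto intro!: group_hom.intro group_hom_axioms.intro P.is_group G.is_group simp: PiE_iff)

lemma lin_ext_eqI:
  assumes "f \<in> hom P G" and t: "t \<in> {..<n} \<rightarrow>\<^sub>E carrier G"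
    and "\<And>j. j < n \<Longrightarrow> f (std_vec n j) = t j" and "v \<in> carrier P"
  shows "lin_ext G n t v = f v"
proof (rule hom_eqI[OF G.is_group _ assms(1)])
  have t': "t \<in> {..<n} \<rightarrow> carrier G" using t by auto
  show "lin_ext G n t \<in> hom P G" by (rule lin_ext_hom[OF G tors t'])
  show "lin_ext G n t (std_vec n j) = f (std_vec n j)" if "j < n" for j
    using lin_ext_std_vec[OF G tors t' that] assms(3)[OF that] by simp
qed fact

lemma presentations_nonempty_iff:
  assumes N: "subgroup N P"
  shows "presentations G N \<noteq> {} \<longleftrightarrow> P Mod N \<cong> G"
proof
  assume "presentations G N \<noteq> {}"
  then obtain t where t: "t \<in> {..<n} \<rightarrow>\<^sub>E carrier G" "lin_ext G n t ` carrier P = carrier G"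
    "kernel P G (lin_ext G n t) = N" by (auto simp: presentations_def)
  show "P Mod N \<cong> G"
    using group_hom.FactGroup_iso[OF group_hom_lin_ext[OF t(1)] t(2)] t(3) by simp
next
  assume "P Mod N \<cong> G"
  then obtain h where h: "h \<in> iso (P Mod N) G" by (auto simp: is_iso_def)
  have nor: "N \<lhd> P" using N by (simp add: P.normal_iff_subgroup)
  define f where "f = h \<circ> (\<lambda>v. N #>\<^bsub>P\<^esub> v)"
  have proj: "(\<lambda>v. N #>\<^bsub>P\<^esub> v) \<in> hom P (P Mod N)"
    using normal.r_coset_hom_Mod[OF nor] .
  have f: "f \<in> hom P G"
    unfolding f_def using hom_compose[OF proj] h by (auto simp: iso_def)
  have surj: "f ` carrier P = carrier G"
    using h unfolding f_def image_comp[symmetric] carrier_FactGroup[symmetric]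
    by (simp add: iso_def bij_betw_def)
  have ker: "kernel P G f = N"
  proof -
    interpret Q: group "P Mod N" by (rule normal.factorgroup_is_group[OF nor])
    have Nc: "N \<in> carrier (P Mod N)" using Q.one_closed by simp
    have h1: "h N = \<one>\<^bsub>G\<^esub>"
      using hom_one[of h "P Mod N" G] h Q.is_group G.is_group by (auto simp: iso_def)
    have "f v = \<one>\<^bsub>G\<^esub> \<longleftrightarrow> v \<in> N" if v: "v \<in> carrier P" for v
    proof -
      have "N #>\<^bsub>P\<^esub> v \<in> carrier (P Mod N)" using v by (auto simp: carrier_FactGroup)
      then have "f v = \<one>\<^bsub>G\<^esub> \<longleftrightarrow> N #>\<^bsub>P\<^esub> v = N"
        using h h1 Nc by (metis (no_types, lifting) bij_betw_def comp_apply f_def inj_on_eq_iff iso_def mem_Collect_eq)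
      also have "\<dots> \<longleftrightarrow> v \<in> N"
        using P.coset_join1[OF _ v N] P.coset_join2[OF v N] by auto
      finally show ?thesis .
    qed
    then show ?thesis using subgroup.subset[OF N] by (auto simp: kernel_def)
  qed
  define t where "t = (\<lambda>j\<in>{..<n}. f (std_vec n j))"
  have t: "t \<in> {..<n} \<rightarrow>\<^sub>E carrier G"
    using f std_vec_P by (auto simp: t_def hom_def)
  have eq: "lin_ext G n t v = f v" if "v \<in> carrier P" for v
    using that by (intro lin_ext_eqI f t) (auto simp: t_def)
  have "lin_ext G n t ` carrier P = carrier G"
    using eq surj by (metis (no_types, lifting) image_cong)
  moreover have "kernel P G (lin_ext G n t) = N"
    using eq ker by (auto simp: kernel_def)
  ultimately show "presentations G N \<noteq> {}" using t by (auto simp: presentations_def)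
qed

text \<open>
  The automorphism group of \<open>G\<close> acts simply transitively on the surjections with a given kernel:
  freely because a tuple of generators determines an automorphism, and transitively by
  \<open>automorphism_between_surjections\<close>.
\<close>

lemma card_presentations:
  assumes N: "subgroup N P"
  shows "card (presentations G N) = (if P Mod N \<cong> G then order (AutoGroup G) else 0)"
proof (cases "P Mod N \<cong> G")
  case True
  then obtain t where "t \<in> presentations G N" using presentations_nonempty_iff[OF N] by blast
  then have t: "t \<in> {..<n} \<rightarrow>\<^sub>E carrier G" "lin_ext G n t ` carrier P = carrier G"
    "kernel P G (lin_ext G n t) = N" by (auto simp: presentations_def)
  have t': "t \<in> {..<n} \<rightarrow> carrier G" using t(1) by auto
  define act where "act = (\<lambda>(a :: 'a \<Rightarrow> 'a). \<lambda>j\<in>{..<n}. a (t j))"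
  note gh = group_hom_lin_ext[OF t(1)]
  interpret t: group_hom P G "lin_ext G n t" by (rule gh)
  have aut: "a \<in> hom G G" "a ` carrier G = carrier G" "inj_on a (carrier G)" "a \<in> extensional (carrier G)"
    if "a \<in> auto G" for a
    using that by (auto simp: auto_def Bij_def bij_betw_def)
  have act_P: "act a \<in> {..<n} \<rightarrow>\<^sub>E carrier G" if "a \<in> auto G" for a
    using aut(1)[OF that] t' by (auto simp: act_def hom_def Pi_iff)
  have act_eq: "lin_ext G n (act a) v = a (lin_ext G n t v)" if a: "a \<in> auto G" and v: "v \<in> carrier P" for a v
  proof -
    have "a \<circ> lin_ext G n t \<in> hom P G"
      by (rule hom_compose[OF t.homh aut(1)[OF a]])
    then have "lin_ext G n (act a) v = (a \<circ> lin_ext G n t) v"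
      by (rule lin_ext_eqI[OF _ act_P[OF a] _ v]) (simp add: act_def lin_ext_std_vec[OF G tors t'])
    then show ?thesis by simp
  qed
  have "bij_betw act (auto G) (presentations G N)"
  proof (rule bij_betw_imageI)
    show "inj_on act (auto G)"
    proof (rule inj_onI)
      fix a b assume a: "a \<in> auto G" and b: "b \<in> auto G" and eq: "act a = act b"
      have "a y = b y" if y: "y \<in> carrier G" for y
      proof -
        obtain v where v: "v \<in> carrier P" "y = lin_ext G n t v" using y t(2) by (metis imageE)
        show ?thesis using act_eq[OF a v(1)] act_eq[OF b v(1)] eq v(2) by simp
      qed
      then show "a = b" using aut(4)[OF a] aut(4)[OF b] by (rule extensionalityI[rotated 2])
    qed
    show "act ` auto G = presentations G N"
    proof
      show "act ` auto G \<subseteq> presentations G N"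
      proof clarify
        fix a assume a: "a \<in> auto G"
        have "lin_ext G n (act a) ` carrier P = a ` lin_ext G n t ` carrier P"
          unfolding image_image using act_eq[OF a] by (intro image_cong) auto
        then have "lin_ext G n (act a) ` carrier P = carrier G" using t(2) aut(2)[OF a] by simp
        moreover have "kernel P G (lin_ext G n (act a)) = N"
        proof -
          have one: "a \<one>\<^bsub>G\<^esub> = \<one>\<^bsub>G\<^esub>"
            by (rule hom_one[OF aut(1)[OF a] G.is_group G.is_group])
          have "a (lin_ext G n t v) = \<one>\<^bsub>G\<^esub> \<longleftrightarrow> lin_ext G n t v = \<one>\<^bsub>G\<^esub>" if "v \<in> carrier P" for v
            using inj_on_eq_iff[OF aut(3)[OF a], of "lin_ext G n t v" "\<one>\<^bsub>G\<^esub>"] that one by auto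
          then show ?thesis
            unfolding t(3)[symmetric] kernel_def using act_eq[OF a] by (intro Collect_cong conj_cong refl) simp
        qed
        ultimately show "act a \<in> presentations G N" using act_P[OF a] by (simp add: presentations_def)
      qed
      show "presentations G N \<subseteq> act ` auto G"
      proof
        fix s assume "s \<in> presentations G N"
        then have s: "s \<in> {..<n} \<rightarrow>\<^sub>E carrier G" "lin_ext G n s ` carrier P = carrier G"
          "kernel P G (lin_ext G n s) = N" by (auto simp: presentations_def)
        have s': "s \<in> {..<n} \<rightarrow> carrier G" using s(1) by auto
        obtain a where a: "a \<in> auto G" "\<And>v. v \<in> carrier P \<Longrightarrow> a (lin_ext G n t v) = lin_ext G n s v"
          using automorphism_between_surjections[OF gh group_hom_lin_ext[OF s(1)] t(2) s(2)] t(3) s(3) by auto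
        have "act a j = s j" for j
        proof (cases "j < n")
          case True
          then show ?thesis
            using a(2)[OF std_vec_P, of j] lin_ext_std_vec[OF G tors t' True] lin_ext_std_vec[OF G tors s' True]
            by (simp add: act_def)
        next
          case False
          then show ?thesis using s(1) by (simp add: act_def PiE_iff extensional_def)
        qed
        then show "s \<in> act ` auto G" using a(1) by (metis ext image_eqI)
      qed
    qed
  qed
  then show ?thesis using True by (simp add: bij_betw_same_card order_def AutoGroup_def)
next
  case False
  then show ?thesis using presentations_nonempty_iff[OF N] by auto
qed

end
end

section \<open>Matrices with a given cokernel\<close>

lemma card_image_mult_kernel:
  assumes h: "group_hom G H f" and M: "subgroup M G" and fin: "finite M"
  shows "card M = card (f ` M) * card {x \<in> M. f x = \<one>\<^bsub>H\<^esub>}"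
proof -
  interpret group_hom G H f by (rule h)
  have Mc: "M \<subseteq> carrier G" using M by (rule subgroup.subset)
  have fib: "card {x \<in> M. f x = y} = card {x \<in> M. f x = \<one>\<^bsub>H\<^esub>}" if y: "y \<in> f ` M" for y
  proof -
    from y obtain z where z: "z \<in> M" "y = f z" by auto
    have zc: "z \<in> carrier G" using z Mc by auto
    have "bij_betw (\<lambda>x. x \<otimes>\<^bsub>G\<^esub> z) {x \<in> M. f x = \<one>\<^bsub>H\<^esub>} {x \<in> M. f x = y}"
    proof (rule bij_betw_byWitness[where f' = "\<lambda>x. x \<otimes>\<^bsub>G\<^esub> inv\<^bsub>G\<^esub> z"])
      show "(\<lambda>x. x \<otimes>\<^bsub>G\<^esub> z) ` {x \<in> M. f x = \<one>\<^bsub>H\<^esub>} \<subseteq> {x \<in> M. f x = y}"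
        using z Mc zc subgroup.m_closed[OF M] by (auto simp: subset_iff)
      show "(\<lambda>x. x \<otimes>\<^bsub>G\<^esub> inv\<^bsub>G\<^esub> z) ` {x \<in> M. f x = y} \<subseteq> {x \<in> M. f x = \<one>\<^bsub>H\<^esub>}"
        using z Mc zc subgroup.m_closed[OF M] subgroup.m_inv_closed[OF M] by (auto simp: subset_iff)
    qed (use z Mc zc in \<open>auto simp: G.m_assoc subset_iff\<close>)
    then show ?thesis by (rule bij_betw_same_card[symmetric])
  qed
  have "card M = card (\<Union>y\<in>f ` M. {x \<in> M. f x = y})"
    by (rule arg_cong[where f = card]) auto
  also have "\<dots> = (\<Sum>y\<in>f ` M. card {x \<in> M. f x = y})"
    using fin by (intro card_UN_disjoint) auto
  also have "\<dots> = card (f ` M) * card {x \<in> M. f x = \<one>\<^bsub>H\<^esub>}"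
    using fib by simp
  finally show ?thesis .
qed

context free_residue_module
begin

text \<open>
  A residue modulo \<open>p\<^sup>k\<close> is killed by \<open>p\<close> if and only if it is divisible by \<open>p\<^bsup>k-1\<^esup>\<close>, and there are
  \<open>p\<close> such residues. In other groups annihilated by \<open>p\<^sup>k\<close> the torsion can be larger than the group of
  multiples; the equality is where freeness of \<open>(\<int>/p\<^sup>k)\<^sup>n\<close> enters.
\<close>

lemma p_torsion_P:
  assumes p: "Factorial_Ring.prime p" and k: "k \<ge> 1" and m: "m = p ^ k"
  shows "{x \<in> carrier P. x [^]\<^bsub>P\<^esub> p = \<one>\<^bsub>P\<^esub>} = multiples P (p ^ (k - 1))"
    and "card (multiples P (p ^ (k - 1))) = p ^ n"
proof -
  define c where "c = p ^ (k - 1)"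
  have p0: "p > 0" using p prime_gt_0_nat by auto
  have c0: "c > 0" using p0 by (simp add: c_def)
  have mc: "m = c * p" using k by (simp add: m c_def power_eq_if mult.commute)
  define D where "D = (\<lambda>z. int c * z) ` {0..<int p}"
  have D_iff: "y \<in> D \<longleftrightarrow> int c dvd y \<and> 0 \<le> y \<and> y < int m" for y
    using c0 by (auto simp: D_def mc dvd_def zero_le_mult_iff image_iff)
  have L: "multiples P c = {..<n} \<rightarrow>\<^sub>E D"
  proof
    show "multiples P c \<subseteq> {..<n} \<rightarrow>\<^sub>E D"
    proof -
      have "x [^]\<^bsub>P\<^esub> c \<in> {..<n} \<rightarrow>\<^sub>E D" if "x \<in> carrier P" for x
        unfolding pow_P[OF that] using p0 by (auto simp: D_def mc simp flip: mult_mod_right)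
      then show ?thesis by (auto simp: multiples_def)
    qed
    show "{..<n} \<rightarrow>\<^sub>E D \<subseteq> multiples P c"
    proof
      fix y assume y: "y \<in> {..<n} \<rightarrow>\<^sub>E D"
      then have yi: "int c dvd y i \<and> 0 \<le> y i \<and> y i < int m" if "i < n" for i
        using that D_iff[of "y i"] by (auto simp: PiE_iff)
      define w where "w = (\<lambda>i\<in>{..<n}. y i div int c)"
      have "y i div int c < int m" if "i < n" for i
      proof -
        have "y i div int c \<le> y i" using yi[OF that] c0 zdiv_mono2[of "y i" 1 "int c"] by simp
        then show ?thesis using yi[OF that] by linarith
      qed
      then have w: "w \<in> carrier P"
        using yi c0 by (auto simp: carrier_P w_def pos_imp_zdiv_nonneg_iff)
      have "y = w [^]\<^bsub>P\<^esub> c"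
        unfolding pow_P[OF w] using yi y by (auto simp: w_def fun_eq_iff PiE_iff extensional_def)
      then show "y \<in> multiples P c" using w by (auto simp: multiples_def)
    qed
  qed
  show "{x \<in> carrier P. x [^]\<^bsub>P\<^esub> p = \<one>\<^bsub>P\<^esub>} = multiples P (p ^ (k - 1))"
    unfolding c_def[symmetric]
  proof
    show "multiples P c \<subseteq> {x \<in> carrier P. x [^]\<^bsub>P\<^esub> p = \<one>\<^bsub>P\<^esub>}"
    proof -
      have "(x [^]\<^bsub>P\<^esub> c) [^]\<^bsub>P\<^esub> p = \<one>\<^bsub>P\<^esub>" if "x \<in> carrier P" for x
        using pow_exponent_P[OF that] P.nat_pow_pow[OF that, of c p] mc by simp
      then show ?thesis unfolding multiples_def by blast
    qed
    show "{x \<in> carrier P. x [^]\<^bsub>P\<^esub> p = \<one>\<^bsub>P\<^esub>} \<subseteq> multiples P c"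
    proof clarify
      fix x assume x: "x \<in> carrier P" and tor: "x [^]\<^bsub>P\<^esub> p = \<one>\<^bsub>P\<^esub>"
      have "x i \<in> D" if i: "i < n" for i
      proof -
        have "(int p * x i) mod int m = 0"
          using fun_cong[OF tor, of i] i by (simp add: pow_P[OF x] one_P)
        then have "int c * int p dvd x i * int p" by (simp add: mc mult.commute mod_eq_0_iff_dvd)
        then have "int c dvd x i" using p0 by simp
        then show ?thesis using x i by (auto simp: D_iff carrier_P PiE_iff)
      qed
      then show "x \<in> multiples P c" using x by (auto simp: L carrier_P PiE_iff)
    qed
  qed
  have "card D = p" using c0 by (simp add: D_def card_image inj_on_def)
  then show "card (multiples P (p ^ (k - 1))) = p ^ n"
    unfolding c_def[symmetric] L by (simp add: card_PiE)
qed

text \<open>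
  The kernel \<open>K\<close> of a surjection onto \<open>G\<close> has rank \<open>n - u\<close> with \<open>u = u_inv p k G\<close>.
  The index of the \<open>p\<close>-th powers in \<open>K\<close> equals the order of the \<open>p\<close>-torsion of \<open>K\<close>. With \<open>L\<close> denoting the \<open>p\<close>-torsion of \<open>(\<int>/p\<^sup>k)\<^sup>n\<close>, which consists of
  the multiples of \<open>p\<^bsup>k-1\<^esup>\<close>, the torsion of \<open>K\<close> is the kernel of the induced surjection from \<open>L\<close>, of
  order \<open>p\<^sup>n\<close>, onto \<open>p\<^bsup>k-1\<^esup>G\<close>, of order \<open>p\<^sup>u\<close>.
\<close>

lemma card_kernel_mod_p:
  assumes p: "Factorial_Ring.prime p" and k: "k \<ge> 1" and m: "m = p ^ k"
    and G: "comm_group G" and fin: "finite (carrier G)"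
    and tors: "\<And>x. x \<in> carrier G \<Longrightarrow> x [^]\<^bsub>G\<^esub> m = \<one>\<^bsub>G\<^esub>"
    and f: "group_hom P G f" and surj: "f ` carrier P = carrier G"
  shows "card (kernel P G f) = p ^ (n - u_inv p k G) * card ((\<lambda>x. x [^]\<^bsub>P\<^esub> p) ` kernel P G f)"
proof -
  interpret f: group_hom P G f by (rule f)
  define K where "K = kernel P G f"
  define u where "u = u_inv p k G"
  define L where "L = multiples P (p ^ (k - 1))"
  have p1: "p > 1" using p prime_gt_1_nat by auto
  have K: "subgroup K P" unfolding K_def by (rule f.subgroup_kernel)
  have finK: "finite K" using K finite_P by (metis finite_subset subgroup.subset)
  have L: "subgroup L P" unfolding L_def multiples_def by (rule P.subgroup_pow_image[OF P.subgroup_self])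
  have finL: "finite L" using L finite_P by (metis finite_subset subgroup.subset)
  have pow: "group_hom P P (\<lambda>x. x [^]\<^bsub>P\<^esub> p)"
    by unfold_locales (auto simp: hom_def P.nat_pow_distrib)
  have "f ` L = multiples G (p ^ (k - 1))"
    unfolding L_def multiples_def surj[symmetric] image_image
    by (intro image_cong) (auto simp: f.hom_nat_pow)
  then have "card (f ` L) = p ^ u"
    using comm_group.card_multiples_eq_u_inv[OF G fin p k] tors m by (simp add: u_def)
  then have "p ^ n = p ^ u * card {x \<in> L. f x = \<one>\<^bsub>G\<^esub>}"
    using card_image_mult_kernel[OF f L finL] p_torsion_P(2)[OF p k m] by (simp add: L_def)
  moreover have eq: "{x \<in> L. f x = \<one>\<^bsub>G\<^esub>} = {x \<in> K. x [^]\<^bsub>P\<^esub> p = \<one>\<^bsub>P\<^esub>}"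
    unfolding L_def p_torsion_P(1)[OF p k m, symmetric] K_def kernel_def by auto
  ultimately have c: "p ^ n = p ^ u * card {x \<in> K. x [^]\<^bsub>P\<^esub> p = \<one>\<^bsub>P\<^esub>}" by simp
  then have "p ^ u dvd p ^ n" by simp
  then have un: "u \<le> n" using p1 by (simp add: power_dvd_imp_le)
  have "p ^ n = p ^ u * p ^ (n - u)" using un by (simp flip: power_add)
  then have "card {x \<in> K. x [^]\<^bsub>P\<^esub> p = \<one>\<^bsub>P\<^esub>} = p ^ (n - u)"
    using c p1 by simp
  then show "card (kernel P G f) = p ^ (n - u_inv p k G) * card ((\<lambda>x. x [^]\<^bsub>P\<^esub> p) ` kernel P G f)"
    using card_image_mult_kernel[OF pow K finK] by (simp add: K_def u_def)
qed

text \<open>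
  Double counting of the pairs \<open>(A, t)\<close> such that \<open>t\<close> is a generating tuple of \<open>G\<close> whose relations are
  the image of \<open>A\<close>. If \<open>G\<close> has no generating tuple of length \<open>n\<close>, both sides vanish, the right one because
  \<open>q (r_inv p G)\<close> has a factor \<open>1 - p\<^sup>n / p\<^sup>n\<close>.
\<close>

lemma card_matrices_with_cokernel:
  fixes G :: "('a, 'b) monoid_scheme"
  assumes p: "Factorial_Ring.prime p" and k: "k \<ge> 1" and m: "m = p ^ k"
    and G: "comm_group G" and fin: "finite (carrier G)"
    and tors: "\<And>x. x \<in> carrier G \<Longrightarrow> x [^]\<^bsub>G\<^esub> m = \<one>\<^bsub>G\<^esub>"
  defines "q \<equiv> \<lambda>r. \<Prod>i<r. 1 - real p ^ i / real p ^ n"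
  shows "real (order (AutoGroup G)) * real (card {A \<in> sq_matrices R n. cok R n A \<cong> G})
       = real (card (sq_matrices R n)) * q (n - u_inv p k G) * q (r_inv p G)"
proof -
  interpret G: comm_group G by (rule G)
  define gens where "gens = {t \<in> {..<n} \<rightarrow>\<^sub>E carrier G. generate G (t ` {..<n}) = carrier G}"
  define ker where "ker = (\<lambda>t. kernel P G (lin_ext G n t))"
  define im where "im = (\<lambda>A. mat_apply R n A ` carrier P)"
  define a where "a = order (AutoGroup G)"
  define u where "u = u_inv p k G"
  have fing: "finite gens" 
    using fin by (intro finite_subset[OF _ finite_PiE[of "{..<n}" "\<lambda>_. carrier G"]]) (auto simp: gens_def)
  have card_gens: "real (card gens) = real (order G) ^ n * q (r_inv p G)"
    unfolding gens_def q_def order_def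
  proof (rule G.card_generating_tuples[OF G.subgroup_self fin p])
    show "x [^]\<^bsub>G\<^esub> (p ^ k) = \<one>\<^bsub>G\<^esub>" if "x \<in> carrier G" for x using tors[OF that] by (simp add: m)
    show "card (carrier G) = p ^ r_inv p G * card ((\<lambda>x. x [^]\<^bsub>G\<^esub> p) ` carrier G)"
      using G.order_eq_r_inv[OF fin p] by (simp add: order_def multiples_def)
  qed
  have hom: "group_hom P G (lin_ext G n t)" and surj: "lin_ext G n t ` carrier P = carrier G"
    if "t \<in> gens" for t
    using that group_hom_lin_ext[OF G tors, of t] lin_ext_image[OF G tors, of t] by (auto simp: gens_def)
  have pres: "presentations G N = {t \<in> gens. N = ker t}" for N
  proof -
    have "lin_ext G n t ` carrier P = generate G (t ` {..<n})" if "t \<in> {..<n} \<rightarrow>\<^sub>E carrier G" for t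
      using that by (intro lin_ext_image[OF G tors]) auto
    then show ?thesis unfolding presentations_def gens_def ker_def by auto
  qed
  have im_sub: "subgroup (im A) P" if "A \<in> sq_matrices R n" for A
  proof -
    interpret A: group_hom P P "mat_apply R n A"
      using mat_apply_hom[OF that] by unfold_locales
    show ?thesis unfolding im_def by (rule A.img_is_subgroup)
  qed
  \<comment> \<open>The factor \<open>|G|\<^sup>n\<close> makes the count independent of \<open>t\<close>, since \<open>|G| |K| = m\<^sup>n\<close> for every kernel \<open>K\<close>.\<close>
  have fibre: "real (order G) ^ n * real (card {A \<in> sq_matrices R n. im A = ker t})
      = real (card (sq_matrices R n)) * q (n - u)" if t: "t \<in> gens" for t
  proof -
    note kn = card_kernel_mod_p[OF p k m G fin tors hom[OF t] surj[OF t]]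
    interpret t: group_hom P G "lin_ext G n t" by (rule hom[OF t])
    have K: "subgroup (ker t) P" unfolding ker_def by (rule t.subgroup_kernel)
    have finK: "finite (ker t)" using K finite_P by (metis finite_subset subgroup.subset)
    have "card (carrier P) = card (carrier G) * card (ker t)"
      using card_image_mult_kernel[OF hom[OF t] P.subgroup_self finite_P] surj[OF t]
      by (simp add: ker_def kernel_def)
    then have KG: "m ^ n = order G * card (ker t)" by (simp add: card_P order_def)
    have "card {A \<in> sq_matrices R n. im A = ker t}
        = card {c \<in> {..<n} \<rightarrow>\<^sub>E ker t. generate P (c ` {..<n}) = ker t}"
      unfolding im_def by (rule card_matrices_with_image[OF subgroup.subset[OF K]])
    also have "real \<dots> = real (card (ker t)) ^ n * q (n - u)"
      unfolding q_def
    proof (rule P.card_generating_tuples[OF K finK p])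
      show "x [^]\<^bsub>P\<^esub> (p ^ k) = \<one>\<^bsub>P\<^esub>" if "x \<in> ker t" for x
        using pow_exponent_P[OF subgroup.mem_carrier[OF K that]] by (simp add: m)
      show "card (ker t) = p ^ (n - u) * card ((\<lambda>x. x [^]\<^bsub>P\<^esub> p) ` ker t)"
        using kn by (simp add: ker_def u_def)
    qed
    finally have "real (card {A \<in> sq_matrices R n. im A = ker t}) = real (card (ker t)) ^ n * q (n - u)" .
    moreover have "real (card (sq_matrices R n)) = real (order G) ^ n * real (card (ker t)) ^ n"
      unfolding card_sq_matrices KG by (simp add: power_mult_distrib)
    ultimately show ?thesis by simp
  qed
  have "a * card {A \<in> sq_matrices R n. cok R n A \<cong> G}
      = (\<Sum>A | A \<in> sq_matrices R n \<and> cok R n A \<cong> G. a)" by simp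
  also have "\<dots> = (\<Sum>A\<in>sq_matrices R n. if cok R n A \<cong> G then a else 0)"
    using finite_sq_matrices by (intro sum.inter_filter)
  also have "\<dots> = (\<Sum>A\<in>sq_matrices R n. card {t \<in> gens. im A = ker t})"
  proof (intro sum.cong refl)
    fix A assume A: "A \<in> sq_matrices R n"
    show "(if cok R n A \<cong> G then a else 0) = card {t \<in> gens. im A = ker t}"
      using card_presentations[OF G tors im_sub[OF A]]
      unfolding pres a_def cok_def im_def by simp
  qed
  also have "\<dots> = (\<Sum>t\<in>gens. card {A \<in> sq_matrices R n. im A = ker t})"
    using finite_sq_matrices fing by (rule sum_multicount_gen) simp
  finally have count_nat: "a * card {A \<in> sq_matrices R n. cok R n A \<cong> G}
      = (\<Sum>t\<in>gens. card {A \<in> sq_matrices R n. im A = ker t})" .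
  have count: "real a * real (card {A \<in> sq_matrices R n. cok R n A \<cong> G})
      = (\<Sum>t\<in>gens. real (card {A \<in> sq_matrices R n. im A = ker t}))"
    using arg_cong[OF count_nat, of real] by simp
  have G0: "order G > 0" using fin G.order_gt_0_iff_finite by simp
  have "real (order G) ^ n * (real a * real (card {A \<in> sq_matrices R n. cok R n A \<cong> G}))
      = (\<Sum>t\<in>gens. real (card (sq_matrices R n)) * q (n - u))"
    unfolding count sum_distrib_left using fibre by (intro sum.cong) auto
  also have "\<dots> = real (order G) ^ n * (real (card (sq_matrices R n)) * q (n - u) * q (r_inv p G))"
    by (simp add: card_gens)
  finally show ?thesis using G0 by (simp add: a_def u_def)
qed

end

lemma prod_one_minus_powi:
  assumes "p > 0"
  shows "(\<Prod>i\<in>{int n - int r + 1..int n}. 1 - real p powi (- i))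
       = (\<Prod>i<r. 1 - real p ^ i / real p ^ n)"
proof -
  have "bij_betw (\<lambda>i. int n - int i) {..<r} {int n - int r + 1..int n}"
    by (rule bij_betw_byWitness[where f' = "\<lambda>i. nat (int n - i)"]) auto
  then have "(\<Prod>i\<in>{int n - int r + 1..int n}. 1 - real p powi (- i))
      = (\<Prod>i<r. 1 - real p powi (- (int n - int i)))"
    by (rule prod.reindex_bij_betw[symmetric])
  also have "\<dots> = (\<Prod>i<r. 1 - real p ^ i / real p ^ n)"
    using assms by (intro prod.cong) (auto simp: power_int_diff)
  finally show ?thesis .
qed

theorem corollary1p7:
  fixes p n k :: nat and G :: "('a, 'b) monoid_scheme"
  assumes "Factorial_Ring.prime p" and "n \<ge> 1" and "k \<ge> 1"
    and "comm_group G" and "finite (carrier G)" and "\<exists>m. order G = p ^ m"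
    and "\<forall>x\<in>carrier G. x [^]\<^bsub>G\<^esub> (p ^ k) = \<one>\<^bsub>G\<^esub>"
  shows "measure_pmf.prob (pmf_of_set (sq_matrices (residue_ring (int (p ^ k))) n))
           {A. cok (residue_ring (int (p ^ k))) n A \<cong> G}
         = 1 / real (order (AutoGroup G))
           * (\<Prod>i\<in>{int (u_inv p k G) + 1..int n}. 1 - real p powi (- i))
           * (\<Prod>i\<in>{int n - int (r_inv p G) + 1..int n}. 1 - real p powi (- i))"
proof -
  interpret G: comm_group G by fact
  have p1: "p > 1" using assms(1) prime_gt_1_nat by auto
  have p0: "p > 0" using p1 by simp
  interpret free_residue_module "p ^ k" n
    using one_less_power[OF p1, of k] assms(3) by unfold_locales simp
  let ?R = "residue_ring (int (p ^ k))"
  let ?S = "sq_matrices ?R n"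
  let ?X = "{A. cok ?R n A \<cong> G}"
  have cardS: "card ?S > 0"
    unfolding card_sq_matrices using p0 by simp
  then have neS: "?S \<noteq> {}" by auto
  have aut0: "order (AutoGroup G) > 0"
  proof -
    have "auto G \<subseteq> carrier G \<rightarrow>\<^sub>E carrier G"
      by (auto simp: auto_def Bij_def hom_def PiE_def)
    then have "finite (auto G)"
      using assms(5) by (meson finite_PiE finite_subset)
    then show ?thesis
      using G.id_in_auto by (auto simp: order_def AutoGroup_def card_gt_0_iff)
  qed
  have count: "real (order (AutoGroup G)) * real (card {A \<in> ?S. cok ?R n A \<cong> G})
      = real (card ?S) * (\<Prod>i<n - u_inv p k G. 1 - real p ^ i / real p ^ n)
        * (\<Prod>i<r_inv p G. 1 - real p ^ i / real p ^ n)"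
    using assms(7) by (intro card_matrices_with_cokernel assms(1,3,4,5) refl) auto
  \<comment> \<open>For \<open>u_inv p k G > n\<close> both intervals are empty, so truncated subtraction does no harm.\<close>
  have "{int (u_inv p k G) + 1..int n} = {int n - int (n - u_inv p k G) + 1..int n}"
    by (cases "u_inv p k G \<le> n") auto
  then have prod_u: "(\<Prod>i\<in>{int (u_inv p k G) + 1..int n}. 1 - real p powi (- i))
      = (\<Prod>i<n - u_inv p k G. 1 - real p ^ i / real p ^ n)"
    by (simp only: prod_one_minus_powi[OF p0])
  have "measure_pmf.prob (pmf_of_set ?S) ?X = real (card (?S \<inter> ?X)) / real (card ?S)"
    by (rule measure_pmf_of_set[OF neS finite_sq_matrices])
  also have "?S \<inter> ?X = {A \<in> ?S. cok ?R n A \<cong> G}" by auto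
  also have "real (card {A \<in> ?S. cok ?R n A \<cong> G}) / real (card ?S)
      = 1 / real (order (AutoGroup G)) * (\<Prod>i<n - u_inv p k G. 1 - real p ^ i / real p ^ n)
        * (\<Prod>i<r_inv p G. 1 - real p ^ i / real p ^ n)"
  proof -
    have "x / s = 1 / a * y * z" if "a * x = s * y * z" "a > 0" "s > 0" for a s x y z :: real
      using that by (simp add: field_simps)
    from this[OF count] aut0 cardS show ?thesis by simp
  qed
  finally show ?thesis unfolding prod_u prod_one_minus_powi[OF p0] .
qed

end
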